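(* The functor $E\colon\mathsf{StrPos}\to\mathsf{FinF}$ is a strict symmetric monoidal functor.
   Context: For a set $X$ and a collection $\mathcal{U}\subseteq\mathcal{P}(X)$ of subsets, put $\mathcal{U}^\perp=\{u'\subseteq X \mid u'\cap u \text{ is finite for all } u\in\mathcal{U}\}$. A finiteness space is a pair $(X,\mathcal{U})$ with $X$ a set and $\mathcal{U}\subseteq\mathcal{P}(X)$ such that $\mathcal{U}^{\perp\perp}=\mathcal{U}$. The category $\mathsf{FinF}$ has finiteness spaces as objects; a morphism $(X,\mathcal{U})\to(Y,\mathcal{V})$ is a (total) function $f\colon X\to Y$ such that (1) $f(u)\in\mathcal{V}$ for all $u\in\mathcal{U}$, and (2) $f^{-1}(v')\in\mathcal{U}^\perp$ for all $v'\in\mathcal{V}^\perp$. It is symmetric monoidal with tensor $(X,\mathcal{U})\otimes(Y,\mathcal{V})=(X\times Y,\mathcal{W})$, where $\mathcal{W}=\{u\times v\mid u\in\mathcal{U},v\in\mathcal{V}\}^{\perp\perp}=\{w\mid \exists u\in\mathcal{U},\exists v\in\mathcal{V},\ w\subseteq u\times v\}$, with $f\otimes g=f\times g$ on morphisms, unit $I=(\{*\},\mathcal{P}(\{*\}))$, and the structural isomorphisms of the cartesian product of sets. A map $f\colon P\to Q$ of posets is strict if $p<p'$ implies $f(p)<f(p')$. $\mathsf{StrPos}$ is the category of posets and strict maps; it is symmetric monoidal with tensor product given by the cartesian product of posets with the componentwise order (the product in the category of posets and order-preserving maps), unit the one-element poset $\{*\}$, and the usual structural isomorphisms of the cartesian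 product. A poset is artinian if every strictly descending chain in it is finite, and narrow if every subset of pairwise incomparable elements is finite; a subset of a poset is artinian or narrow if it is so for the induced order. The functor $E\colon\mathsf{StrPos}\to\mathsf{FinF}$ sends a poset $(P,\leq)$ to the finiteness space $(P,\mathcal{U})$, where $\mathcal{U}$ is the set of artinian and narrow subsets of $P$, and a strict map $f$ to $E(f)=f$. *)

theory Defs
  imports "HOL-Library.FuncSet"
begin

section \<open>Symmetric monoidal categories and strict symmetric monoidal functors\<close>

record ('o, 'm) category_data =
  Obj :: "'o set"
  Mor :: "'m set"
  Dom :: "'m \<Rightarrow> 'o"
  Cod :: "'m \<Rightarrow> 'o"
  Ident :: "'o \<Rightarrow> 'm"
  Comp :: "'m \<Rightarrow> 'm \<Rightarrow> 'm"  (infixl "\<cdot>\<index>" 60)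

definition Hom :: "('o, 'm, 'z) category_data_scheme \<Rightarrow> 'o \<Rightarrow> 'o \<Rightarrow> 'm set" where
  "Hom C A B = {f \<in> Mor C. Dom C f = A \<and> Cod C f = B}"

text \<open>Composition is written in applicative order: \<open>g \<cdot> f\<close> is \<open>f\<close> followed by \<open>g\<close>.\<close>

locale category =
  fixes C :: "('o, 'm, 'z) category_data_scheme" (structure)
  assumes Dom_Obj: "f \<in> Mor C \<Longrightarrow> Dom C f \<in> Obj C"
    and Cod_Obj: "f \<in> Mor C \<Longrightarrow> Cod C f \<in> Obj C"
    and Ident_Hom: "A \<in> Obj C \<Longrightarrow> Ident C A \<in> Hom C A A"
    and Comp_Hom: "\<lbrakk>f \<in> Hom C A B; g \<in> Hom C B D\<rbrakk> \<Longrightarrow> g \<cdot> f \<in> Hom C A D"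
    and Comp_Ident: "f \<in> Hom C A B \<Longrightarrow> f \<cdot> Ident C A = f"
    and Ident_Comp: "f \<in> Hom C A B \<Longrightarrow> Ident C B \<cdot> f = f"
    and Comp_assoc: "\<lbrakk>f \<in> Hom C A B; g \<in> Hom C B D; h \<in> Hom C D E\<rbrakk>
                      \<Longrightarrow> (h \<cdot> g) \<cdot> f = h \<cdot> (g \<cdot> f)"

definition iso_in :: "('o, 'm, 'z) category_data_scheme \<Rightarrow> 'm \<Rightarrow> 'o \<Rightarrow> 'o \<Rightarrow> bool" where
  "iso_in C f A B \<longleftrightarrow> f \<in> Hom C A B \<and>
     (\<exists>g \<in> Hom C B A. Comp C g f = Ident C A \<and> Comp C f g = Ident C B)"

record ('o, 'm) monoidal_data = "('o, 'm) category_data" +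
  TensorO :: "'o \<Rightarrow> 'o \<Rightarrow> 'o"  (infixl "\<otimes>\<index>" 70)
  TensorM :: "'m \<Rightarrow> 'm \<Rightarrow> 'm"  (infixl "\<boxtimes>\<index>" 70)
  UnitO :: "'o"
  Assoc :: "'o \<Rightarrow> 'o \<Rightarrow> 'o \<Rightarrow> 'm"
  LUnit :: "'o \<Rightarrow> 'm"
  RUnit :: "'o \<Rightarrow> 'm"
  Symm :: "'o \<Rightarrow> 'o \<Rightarrow> 'm"

locale symmetric_monoidal_category = category C
  for C :: "('o, 'm, 'z) monoidal_data_scheme" (structure) +
  assumes Tensor_Obj: "\<lbrakk>A \<in> Obj C; B \<in> Obj C\<rbrakk> \<Longrightarrow> A \<otimes> B \<in> Obj C"
    and Unit_Obj: "UnitO C \<in> Obj C"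
    and Tensor_Hom: "\<lbrakk>f \<in> Hom C A A'; g \<in> Hom C B B'\<rbrakk>
          \<Longrightarrow> f \<boxtimes> g \<in> Hom C (A \<otimes> B) (A' \<otimes> B')"
    and Tensor_Ident: "\<lbrakk>A \<in> Obj C; B \<in> Obj C\<rbrakk>
          \<Longrightarrow> Ident C A \<boxtimes> Ident C B = Ident C (A \<otimes> B)"
    and Tensor_Comp: "\<lbrakk>f \<in> Hom C A A'; f' \<in> Hom C A' A''; g \<in> Hom C B B'; g' \<in> Hom C B' B''\<rbrakk>
          \<Longrightarrow> (f' \<cdot> f) \<boxtimes> (g' \<cdot> g) = (f' \<boxtimes> g') \<cdot> (f \<boxtimes> g)"
    and Assoc_iso: "\<lbrakk>A \<in> Obj C; B \<in> Obj C; D \<in> Obj C\<rbrakk>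
          \<Longrightarrow> iso_in C (Assoc C A B D) ((A \<otimes> B) \<otimes> D) (A \<otimes> (B \<otimes> D))"
    and Assoc_natural: "\<lbrakk>f \<in> Hom C A A'; g \<in> Hom C B B'; h \<in> Hom C D D'\<rbrakk>
          \<Longrightarrow> Assoc C A' B' D' \<cdot> ((f \<boxtimes> g) \<boxtimes> h) = (f \<boxtimes> (g \<boxtimes> h)) \<cdot> Assoc C A B D"
    and LUnit_iso: "A \<in> Obj C \<Longrightarrow> iso_in C (LUnit C A) (UnitO C \<otimes> A) A"
    and LUnit_natural: "f \<in> Hom C A B
          \<Longrightarrow> LUnit C B \<cdot> (Ident C (UnitO C) \<boxtimes> f) = f \<cdot> LUnit C A"
    and RUnit_iso: "A \<in> Obj C \<Longrightarrow> iso_in C (RUnit C A) (A \<otimes> UnitO C) A"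
    and RUnit_natural: "f \<in> Hom C A B
          \<Longrightarrow> RUnit C B \<cdot> (f \<boxtimes> Ident C (UnitO C)) = f \<cdot> RUnit C A"
    and Symm_iso: "\<lbrakk>A \<in> Obj C; B \<in> Obj C\<rbrakk> \<Longrightarrow> iso_in C (Symm C A B) (A \<otimes> B) (B \<otimes> A)"
    and Symm_natural: "\<lbrakk>f \<in> Hom C A A'; g \<in> Hom C B B'\<rbrakk>
          \<Longrightarrow> Symm C A' B' \<cdot> (f \<boxtimes> g) = (g \<boxtimes> f) \<cdot> Symm C A B"
    and triangle: "\<lbrakk>A \<in> Obj C; B \<in> Obj C\<rbrakk>
          \<Longrightarrow> (Ident C A \<boxtimes> LUnit C B) \<cdot> Assoc C A (UnitO C) B = RUnit C A \<boxtimes> Ident C B"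
    and pentagon: "\<lbrakk>A \<in> Obj C; B \<in> Obj C; D \<in> Obj C; E \<in> Obj C\<rbrakk>
          \<Longrightarrow> Assoc C A B (D \<otimes> E) \<cdot> Assoc C (A \<otimes> B) D E =
              (Ident C A \<boxtimes> Assoc C B D E) \<cdot> (Assoc C A (B \<otimes> D) E \<cdot> (Assoc C A B D \<boxtimes> Ident C E))"
    and Symm_unit: "A \<in> Obj C \<Longrightarrow> LUnit C A \<cdot> Symm C A (UnitO C) = RUnit C A"
    and Symm_involution: "\<lbrakk>A \<in> Obj C; B \<in> Obj C\<rbrakk> \<Longrightarrow> Symm C B A \<cdot> Symm C A B = Ident C (A \<otimes> B)"
    and hexagon: "\<lbrakk>A \<in> Obj C; B \<in> Obj C; D \<in> Obj C\<rbrakk>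
          \<Longrightarrow> Assoc C B D A \<cdot> (Symm C A (B \<otimes> D) \<cdot> Assoc C A B D) =
              (Ident C B \<boxtimes> Symm C A D) \<cdot> (Assoc C B A D \<cdot> (Symm C A B \<boxtimes> Ident C D))"

locale covariant_functor =
  source: category C + target: category D
  for C :: "('o, 'm, 'y) category_data_scheme"
    and D :: "('p, 'n, 'z) category_data_scheme" +
  fixes Fo :: "'o \<Rightarrow> 'p" and Fm :: "'m \<Rightarrow> 'n"
  assumes map_Obj: "A \<in> Obj C \<Longrightarrow> Fo A \<in> Obj D"
    and map_Hom: "f \<in> Hom C A B \<Longrightarrow> Fm f \<in> Hom D (Fo A) (Fo B)"
    and map_Ident: "A \<in> Obj C \<Longrightarrow> Fm (Ident C A) = Ident D (Fo A)"
    and map_Comp: "\<lbrakk>f \<in> Hom C A A'; g \<in> Hom C A' A''\<rbrakk> \<Longrightarrow> Fm (g \<cdot>\<^bsub>C\<^esub> f) = Fm g \<cdot>\<^bsub>D\<^esub> Fm f"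

locale strict_symmetric_monoidal_functor =
  source: symmetric_monoidal_category C + target: symmetric_monoidal_category D +
  covariant_functor C D Fo Fm
  for C :: "('o, 'm, 'y) monoidal_data_scheme"
    and D :: "('p, 'n, 'z) monoidal_data_scheme"
    and Fo :: "'o \<Rightarrow> 'p" and Fm :: "'m \<Rightarrow> 'n" +
  assumes map_UnitO: "Fo (UnitO C) = UnitO D"
    and map_TensorO: "\<lbrakk>A \<in> Obj C; B \<in> Obj C\<rbrakk> \<Longrightarrow> Fo (A \<otimes>\<^bsub>C\<^esub> B) = Fo A \<otimes>\<^bsub>D\<^esub> Fo B"
    and map_TensorM: "\<lbrakk>f \<in> Mor C; g \<in> Mor C\<rbrakk> \<Longrightarrow> Fm (f \<boxtimes>\<^bsub>C\<^esub> g) = Fm f \<boxtimes>\<^bsub>D\<^esub> Fm g"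
    and map_Assoc: "\<lbrakk>A \<in> Obj C; A' \<in> Obj C; A'' \<in> Obj C\<rbrakk>
          \<Longrightarrow> Fm (Assoc C A A' A'') = Assoc D (Fo A) (Fo A') (Fo A'')"
    and map_LUnit: "A \<in> Obj C \<Longrightarrow> Fm (LUnit C A) = LUnit D (Fo A)"
    and map_RUnit: "A \<in> Obj C \<Longrightarrow> Fm (RUnit C A) = RUnit D (Fo A)"
    and map_Symm: "\<lbrakk>A \<in> Obj C; B \<in> Obj C\<rbrakk> \<Longrightarrow> Fm (Symm C A B) = Symm D (Fo A) (Fo B)"


section \<open>Sets and their cartesian products\<close>

text \<open>
  All objects of a category have to live in one type, whereas the product type of \<open>'a\<close> and
  \<open>'b\<close> is a new type. The role of the class of all sets is therefore played by the sets over
  the following type, whose elements are closed under ordered pairs and contain a base point.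
  The type parameter is arbitrary, and \<open>Atom\<close> embeds every set over \<open>'a\<close>.
\<close>

datatype 'a univ = Point | Atom 'a | Tup "'a univ" "'a univ"

definition cart :: "'a univ set \<Rightarrow> 'a univ set \<Rightarrow> 'a univ set" where
  "cart X Y = {Tup x y | x y. x \<in> X \<and> y \<in> Y}"

fun cart_map :: "('a univ \<Rightarrow> 'a univ) \<Rightarrow> ('a univ \<Rightarrow> 'a univ) \<Rightarrow> 'a univ \<Rightarrow> 'a univ" where
  "cart_map f g (Tup x y) = Tup (f x) (g y)"

fun cart_assoc :: "'a univ \<Rightarrow> 'a univ" where
  "cart_assoc (Tup (Tup x y) z) = Tup x (Tup y z)"

fun cart_lunit :: "'a univ \<Rightarrow> 'a univ" where
  "cart_lunit (Tup p x) = x"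

fun cart_runit :: "'a univ \<Rightarrow> 'a univ" where
  "cart_runit (Tup x p) = x"

fun cart_swap :: "'a univ \<Rightarrow> 'a univ" where
  "cart_swap (Tup x y) = Tup y x"

datatype ('o, 'u) arrow = Arrow (src: 'o) (fn: "'u \<Rightarrow> 'u") (tgt: 'o)

text \<open>
  The category of sets with structure: \<open>U\<close> is the underlying set of an object and
  \<open>M A B f\<close> says that the function \<open>f : U A \<rightarrow> U B\<close> preserves the structure. A function
  on a set is represented by its extension with the value \<open>undefined\<close> elsewhere, so that
  equality of arrows is equality of functions. Tensor of maps and structural
  isomorphisms are those of the cartesian product, so \<open>T\<close> and \<open>I\<close> are meant to satisfy
  \<open>U (T A B) = cart (U A) (U B)\<close> and \<open>U I = {Point}\<close>.
\<close>

definition concrete_monoidal ::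
  "'o set \<Rightarrow> ('o \<Rightarrow> 'a univ set) \<Rightarrow> ('o \<Rightarrow> 'o \<Rightarrow> ('a univ \<Rightarrow> 'a univ) \<Rightarrow> bool)
    \<Rightarrow> ('o \<Rightarrow> 'o \<Rightarrow> 'o) \<Rightarrow> 'o \<Rightarrow> ('o, ('o, 'a univ) arrow) monoidal_data" where
  "concrete_monoidal Ob U M T I =
    \<lparr>Obj = Ob,
     Mor = {Arrow A f B | A f B. A \<in> Ob \<and> B \<in> Ob \<and> f \<in> U A \<rightarrow>\<^sub>E U B \<and> M A B f},
     Dom = src,
     Cod = tgt,
     Ident = (\<lambda>A. Arrow A (restrict id (U A)) A),
     Comp = (\<lambda>g f. Arrow (src f) (compose (U (src f)) (fn g) (fn f)) (tgt g)),
     TensorO = T,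
     TensorM = (\<lambda>f g. Arrow (T (src f) (src g))
                         (restrict (cart_map (fn f) (fn g)) (U (T (src f) (src g))))
                         (T (tgt f) (tgt g))),
     UnitO = I,
     Assoc = (\<lambda>A B C. Arrow (T (T A B) C) (restrict cart_assoc (U (T (T A B) C))) (T A (T B C))),
     LUnit = (\<lambda>A. Arrow (T I A) (restrict cart_lunit (U (T I A))) A),
     RUnit = (\<lambda>A. Arrow (T A I) (restrict cart_runit (U (T A I))) A),
     Symm = (\<lambda>A B. Arrow (T A B) (restrict cart_swap (U (T A B))) (T B A))\<rparr>"


section \<open>The category of finiteness spaces\<close>

definition perp :: "'u set \<Rightarrow> 'u set set \<Rightarrow> 'u set set" where
  "perp X \<U> = {u'. u' \<subseteq> X \<and> (\<forall>u\<in>\<U>. finite (u' \<inter> u))}"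

datatype 'u finspace = FinSpace (web: "'u set") (fins: "'u set set")

abbreviation cofins :: "'u finspace \<Rightarrow> 'u set set" where
  "cofins A \<equiv> perp (web A) (fins A)"

definition finiteness_space :: "'u finspace \<Rightarrow> bool" where
  "finiteness_space A \<longleftrightarrow> fins A \<subseteq> Pow (web A) \<and> perp (web A) (perp (web A) (fins A)) = fins A"

definition finf_map :: "'u finspace \<Rightarrow> 'u finspace \<Rightarrow> ('u \<Rightarrow> 'u) \<Rightarrow> bool" where
  "finf_map A B f \<longleftrightarrow>
     (\<forall>u \<in> fins A. f ` u \<in> fins B) \<and> (\<forall>v' \<in> cofins B. f -` v' \<inter> web A \<in> cofins A)"

definition fin_tensor :: "'a univ finspace \<Rightarrow> 'a univ finspace \<Rightarrow> 'a univ finspace" where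
  "fin_tensor A B =
     (let Z = cart (web A) (web B)
      in FinSpace Z (perp Z (perp Z {cart u v | u v. u \<in> fins A \<and> v \<in> fins B})))"

definition fin_unit :: "'a univ finspace" where
  "fin_unit = FinSpace {Point} (Pow {Point})"

definition FinF :: "('a univ finspace, ('a univ finspace, 'a univ) arrow) monoidal_data" where
  "FinF = concrete_monoidal {A. finiteness_space A} web finf_map fin_tensor fin_unit"


section \<open>The category of posets and strict maps\<close>

datatype 'u pos = Pos (pts: "'u set") (leq: "('u \<times> 'u) set")

definition is_poset :: "'u pos \<Rightarrow> bool" where
  "is_poset P \<longleftrightarrow> partial_order_on (pts P) (leq P)"

definition lt :: "'u pos \<Rightarrow> 'u \<Rightarrow> 'u \<Rightarrow> bool" where
  "lt P x y \<longleftrightarrow> (x, y) \<in> leq P \<and> x \<noteq> y"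

definition strict_map :: "'u pos \<Rightarrow> 'u pos \<Rightarrow> ('u \<Rightarrow> 'u) \<Rightarrow> bool" where
  "strict_map P Q f \<longleftrightarrow> (\<forall>p\<in>pts P. \<forall>p'\<in>pts P. lt P p p' \<longrightarrow> lt Q (f p) (f p'))"

definition pos_tensor :: "'a univ pos \<Rightarrow> 'a univ pos \<Rightarrow> 'a univ pos" where
  "pos_tensor P Q = Pos (cart (pts P) (pts Q))
     {(Tup p q, Tup p' q') | p q p' q'. (p, p') \<in> leq P \<and> (q, q') \<in> leq Q}"

definition pos_unit :: "'a univ pos" where
  "pos_unit = Pos {Point} {(Point, Point)}"

definition StrPos :: "('a univ pos, ('a univ pos, 'a univ) arrow) monoidal_data" where
  "StrPos = concrete_monoidal {P. is_poset P} pts strict_map pos_tensor pos_unit"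


section \<open>The functor from posets to finiteness spaces\<close>

definition artinian :: "'u pos \<Rightarrow> bool" where
  "artinian P \<longleftrightarrow> \<not> (\<exists>s :: nat \<Rightarrow> 'u. (\<forall>n. s n \<in> pts P) \<and> (\<forall>n. lt P (s (Suc n)) (s n)))"

definition narrow :: "'u pos \<Rightarrow> bool" where
  "narrow P \<longleftrightarrow>
     (\<forall>S \<subseteq> pts P. (\<forall>x\<in>S. \<forall>y\<in>S. x \<noteq> y \<longrightarrow> (x, y) \<notin> leq P \<and> (y, x) \<notin> leq P) \<longrightarrow> finite S)"

definition induced :: "'u pos \<Rightarrow> 'u set \<Rightarrow> 'u pos" where
  "induced P u = Pos u (leq P \<inter> u \<times> u)"

definition E_obj :: "'u pos \<Rightarrow> 'u finspace" where
  "E_obj P = FinSpace (pts P) {u. u \<subseteq> pts P \<and> artinian (induced P u) \<and> narrow (induced P u)}"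

definition E_mor :: "('u pos, 'u) arrow \<Rightarrow> ('u finspace, 'u) arrow" where
  "E_mor f = Arrow (E_obj (src f)) (fn f) (E_obj (tgt f))"

end

(* A subset u of a poset is artinian and narrow iff every sequence s in u has indices i < j with
   s i <= s j, and by Ramsey's theorem such a u even has, for every s, a weakly increasing
   subsequence. With this criterion the statements about E become statements about sequences.
   On the side of finiteness spaces, a set belongs to a tensor product iff both projections belong
   to the factors, and a map is a morphism iff it preserves the finitary sets and has finite fibres
   on each of them. *)

theory Submission
  imports Defs "HOL-Library.Ramsey"
begin

section \<open>Categories of sets with structure\<close>

text \<open>The coherence equations do not depend on the structure carried by the objects: they are
  equalities of functions on products of sets. They are therefore proved once, and each category
  only has to show that its structure is stable under the maps involved. Strictness then rests on
  two equalities of objects, for the unit and for the tensor product. The tensor product is the hard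
  one. Knowing a pair \<open>i < j\<close> with \<open>s i\<close> below \<open>s j\<close> in each
  coordinate separately is not enough, because the two pairs may differ. A weakly increasing
  subsequence in the first coordinate removes this obstacle: every pair of its indices is good
  there, so the second coordinate may choose. On the side of finiteness spaces, both the tensor
  product and the morphisms are defined through duals, about which the order gives no direct
  information. The two reformulations speak of \<open>fins\<close> alone, where the sequence
  criterion applies.\<close>

lemma Tup_in_cart [simp]: "Tup x y \<in> cart X Y \<longleftrightarrow> x \<in> X \<and> y \<in> Y"
  by (auto simp: cart_def)

lemma in_cartE [elim!]:
  assumes "z \<in> cart X Y"
  obtains x y where "z = Tup x y" "x \<in> X" "y \<in> Y"
  using assms by (auto simp: cart_def)

text \<open>The inverse of \<open>cart_assoc\<close> on nested pairs, needed as the witness in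
  \<open>iso_in\<close>.\<close>

fun cart_unassoc :: "'a univ \<Rightarrow> 'a univ" where
  "cart_unassoc (Tup x (Tup y z)) = Tup (Tup x y) z"

text \<open>The assumptions are what remains to be checked once equations between arrows are reduced
  to equations between functions. \<open>M_cong\<close> is there because arrows carry restricted
  functions, so \<open>M A B\<close> must depend only on the values on \<open>U A\<close>. Inverses
  occur among the assumptions because the inverse of a structural map has to be a morphism too;
  \<open>cart_swap\<close> is its own inverse.\<close>

locale concrete_monoidal_structure =
  fixes Ob :: "'o set" and U :: "'o \<Rightarrow> 'a univ set"
    and M :: "'o \<Rightarrow> 'o \<Rightarrow> ('a univ \<Rightarrow> 'a univ) \<Rightarrow> bool"
    and T :: "'o \<Rightarrow> 'o \<Rightarrow> 'o" and I :: 'o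
  assumes M_cong: "\<lbrakk>A \<in> Ob; B \<in> Ob; \<And>x. x \<in> U A \<Longrightarrow> f x = g x; M A B f\<rbrakk> \<Longrightarrow> M A B g"
    and M_id: "A \<in> Ob \<Longrightarrow> M A A id"
    and M_comp: "\<lbrakk>A \<in> Ob; B \<in> Ob; D \<in> Ob; f \<in> U A \<rightarrow> U B; g \<in> U B \<rightarrow> U D; M A B f; M B D g\<rbrakk>
                  \<Longrightarrow> M A D (g \<circ> f)"
    and T_Ob: "\<lbrakk>A \<in> Ob; B \<in> Ob\<rbrakk> \<Longrightarrow> T A B \<in> Ob"
    and I_Ob: "I \<in> Ob"
    and U_T: "U (T A B) = cart (U A) (U B)"
    and U_I: "U I = {Point}"
    and M_cart_map: "\<lbrakk>A \<in> Ob; A' \<in> Ob; B \<in> Ob; B' \<in> Ob; f \<in> U A \<rightarrow> U A'; g \<in> U B \<rightarrow> U B';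
                      M A A' f; M B B' g\<rbrakk> \<Longrightarrow> M (T A B) (T A' B') (cart_map f g)"
    and M_assoc: "\<lbrakk>A \<in> Ob; B \<in> Ob; D \<in> Ob\<rbrakk> \<Longrightarrow> M (T (T A B) D) (T A (T B D)) cart_assoc"
    and M_unassoc: "\<lbrakk>A \<in> Ob; B \<in> Ob; D \<in> Ob\<rbrakk> \<Longrightarrow> M (T A (T B D)) (T (T A B) D) cart_unassoc"
    and M_lunit: "A \<in> Ob \<Longrightarrow> M (T I A) A cart_lunit"
    and M_lunit_inv: "A \<in> Ob \<Longrightarrow> M A (T I A) (Tup Point)"
    and M_swap: "\<lbrakk>A \<in> Ob; B \<in> Ob\<rbrakk> \<Longrightarrow> M (T A B) (T B A) cart_swap"
begin

abbreviation "C \<equiv> concrete_monoidal Ob U M T I"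

text \<open>On pairs, \<open>cart_runit\<close> is \<open>cart_swap\<close> followed by
  \<open>cart_lunit\<close>, so the right unit is obtained from the left one by symmetry.\<close>

lemma M_runit:
  assumes "A \<in> Ob" shows "M (T A I) A cart_runit"
  by (rule M_cong[OF _ _ _ M_comp[of _ "T I A" _ cart_swap cart_lunit]])
    (use assms in \<open>auto simp: T_Ob I_Ob U_T U_I M_swap M_lunit\<close>)

lemma M_runit_inv:
  assumes "A \<in> Ob" shows "M A (T A I) (\<lambda>x. Tup x Point)"
  by (rule M_cong[OF _ _ _ M_comp[of _ "T I A" _ "Tup Point" cart_swap]])
    (use assms in \<open>auto simp: T_Ob I_Ob U_T U_I M_swap M_lunit_inv\<close>)

lemma C_sel [simp]:
  "Obj C = Ob"
  "Dom C = src"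
  "Cod C = tgt"
  "Ident C A = Arrow A (restrict id (U A)) A"
  "Comp C g f = Arrow (src f) (compose (U (src f)) (fn g) (fn f)) (tgt g)"
  "TensorO C = T"
  "TensorM C f g = Arrow (T (src f) (src g))
     (restrict (cart_map (fn f) (fn g)) (U (T (src f) (src g)))) (T (tgt f) (tgt g))"
  "UnitO C = I"
  "Assoc C A B D = Arrow (T (T A B) D) (restrict cart_assoc (U (T (T A B) D))) (T A (T B D))"
  "LUnit C A = Arrow (T I A) (restrict cart_lunit (U (T I A))) A"
  "RUnit C A = Arrow (T A I) (restrict cart_runit (U (T A I))) A"
  "Symm C A B = Arrow (T A B) (restrict cart_swap (U (T A B))) (T B A)"
  by (simp_all add: concrete_monoidal_def)

lemma Mor_iff: "f \<in> Mor C \<longleftrightarrow> src f \<in> Ob \<and> tgt f \<in> Ob \<and>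
    fn f \<in> U (src f) \<rightarrow>\<^sub>E U (tgt f) \<and> M (src f) (tgt f) (fn f)"
  by (cases f) (simp add: concrete_monoidal_def)

lemma HomE [elim!]:
  assumes "f \<in> Hom C A B"
  obtains \<phi> where "f = Arrow A \<phi> B" "A \<in> Ob" "B \<in> Ob" "\<phi> \<in> U A \<rightarrow>\<^sub>E U B" "M A B \<phi>"
  using assms by (cases f) (auto simp: Hom_def Mor_iff)

lemma restrict_Hom:
  assumes "A \<in> Ob" "B \<in> Ob" "f \<in> U A \<rightarrow> U B" "M A B f"
  shows "Arrow A (restrict f (U A)) B \<in> Hom C A B"
proof -
  have "M A B (restrict f (U A))"
    by (rule M_cong[OF assms(1,2) _ assms(4)]) simp
  then show ?thesis
    using assms by (auto simp: Hom_def Mor_iff)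
qed

lemma iso_in_restrict:
  assumes "A \<in> Ob" "B \<in> Ob" "f \<in> U A \<rightarrow> U B" "g \<in> U B \<rightarrow> U A" "M A B f" "M B A g"
    and "\<And>x. x \<in> U A \<Longrightarrow> g (f x) = x" "\<And>y. y \<in> U B \<Longrightarrow> f (g y) = y"
  shows "iso_in C (Arrow A (restrict f (U A)) B) A B"
  unfolding iso_in_def
proof (intro conjI bexI)
  show "Arrow A (restrict f (U A)) B \<in> Hom C A B" "Arrow B (restrict g (U B)) A \<in> Hom C B A"
    using assms by (auto intro!: restrict_Hom)
qed (use assms in \<open>auto simp: compose_def fun_eq_iff\<close>)

lemma category_C: "category C"
proof
  fix A f B assume "f \<in> Hom C A B"
  then obtain \<phi> where \<phi>: "f = Arrow A \<phi> B" "\<phi> \<in> U A \<rightarrow>\<^sub>E U B" by auto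
  show "Comp C f (Ident C A) = f"
    using \<phi> by (auto simp: fun_eq_iff compose_def PiE_iff extensional_def)
  show "Comp C (Ident C B) f = f"
    using \<phi> by (auto simp: fun_eq_iff compose_def PiE_iff extensional_def)
next
  fix A f B g D assume "f \<in> Hom C A B" "g \<in> Hom C B D"
  then obtain \<phi> \<psi> where *: "f = Arrow A \<phi> B" "\<phi> \<in> U A \<rightarrow>\<^sub>E U B" "M A B \<phi>"
    "g = Arrow B \<psi> D" "\<psi> \<in> U B \<rightarrow>\<^sub>E U D" "M B D \<psi>" "A \<in> Ob" "B \<in> Ob" "D \<in> Ob" by auto
  have "M A D (\<psi> \<circ> \<phi>)"
    using * by (intro M_comp[of A B D]) auto
  then have "Arrow A (restrict (\<psi> \<circ> \<phi>) (U A)) D \<in> Hom C A D"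
    using * by (intro restrict_Hom) auto
  moreover have "restrict (\<psi> \<circ> \<phi>) (U A) = compose (U A) \<psi> \<phi>"
    by (auto simp: compose_def)
  ultimately show "Comp C g f \<in> Hom C A D"
    using * by simp
next
  fix A f B g D h E assume "f \<in> Hom C A B" "g \<in> Hom C B D" "h \<in> Hom C D E"
  then obtain \<phi> \<psi> \<chi> where *: "f = Arrow A \<phi> B" "\<phi> \<in> U A \<rightarrow>\<^sub>E U B"
    "g = Arrow B \<psi> D" "\<psi> \<in> U B \<rightarrow>\<^sub>E U D" "h = Arrow D \<chi> E" by auto
  then show "Comp C (Comp C h g) f = Comp C h (Comp C g f)"
    by (auto intro!: restrict_ext simp: compose_def PiE_iff)
next
  fix A assume "A \<in> Obj C"
  then show "Ident C A \<in> Hom C A A"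
    using restrict_Hom[of A A id] by (simp add: M_id)
qed (auto simp: Mor_iff)

lemma symmetric_monoidal_category_C: "symmetric_monoidal_category C"
proof -
  interpret category C by (rule category_C)
  note [simp] = T_Ob I_Ob U_T U_I M_id M_assoc M_unassoc M_lunit M_lunit_inv M_runit M_runit_inv M_swap
  show ?thesis
  proof
    fix A f A' B g B' assume "f \<in> Hom C A A'" "g \<in> Hom C B B'"
    then obtain \<phi> \<psi> where *: "f = Arrow A \<phi> A'" "\<phi> \<in> U A \<rightarrow>\<^sub>E U A'" "M A A' \<phi>"
      "g = Arrow B \<psi> B'" "\<psi> \<in> U B \<rightarrow>\<^sub>E U B'" "M B B' \<psi>" "A \<in> Ob" "A' \<in> Ob" "B \<in> Ob" "B' \<in> Ob"
      by auto
    have "M (T A B) (T A' B') (cart_map \<phi> \<psi>)"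
      using * by (intro M_cart_map) auto
    with restrict_Hom[of "T A B" "T A' B'" "cart_map \<phi> \<psi>"]
    show "TensorM C f g \<in> Hom C (TensorO C A B) (TensorO C A' B')"
      using * by (force simp del: U_T simp: U_T[of A B] U_T[of A' B'])
    show "Comp C (Symm C A' B') (TensorM C f g) = Comp C (TensorM C g f) (Symm C A B)"
      using * by (auto intro!: restrict_ext simp: compose_def PiE_iff)
    fix D h D' assume "h \<in> Hom C D D'"
    then obtain \<chi> where "h = Arrow D \<chi> D'" "\<chi> \<in> U D \<rightarrow>\<^sub>E U D'" by auto
    with * show "Comp C (Assoc C A' B' D') (TensorM C (TensorM C f g) h) =
        Comp C (TensorM C f (TensorM C g h)) (Assoc C A B D)"
      by (auto intro!: restrict_ext simp: compose_def PiE_iff)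
  next
    fix A f A' f' A'' B g B' g' B''
    assume "f \<in> Hom C A A'" "f' \<in> Hom C A' A''" "g \<in> Hom C B B'" "g' \<in> Hom C B' B''"
    then obtain \<phi> \<phi>' \<psi> \<psi>' where "f = Arrow A \<phi> A'" "\<phi> \<in> U A \<rightarrow>\<^sub>E U A'"
      "f' = Arrow A' \<phi>' A''" "g = Arrow B \<psi> B'" "\<psi> \<in> U B \<rightarrow>\<^sub>E U B'" "g' = Arrow B' \<psi>' B''"
      by auto
    then show "TensorM C (Comp C f' f) (Comp C g' g) = Comp C (TensorM C f' g') (TensorM C f g)"
      by (auto intro!: restrict_ext simp: compose_def PiE_iff)
  next
    fix A f B assume "f \<in> Hom C A B"
    then obtain \<phi> where \<phi>: "f = Arrow A \<phi> B" "\<phi> \<in> U A \<rightarrow>\<^sub>E U B" by auto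
    show "Comp C (LUnit C B) (TensorM C (Ident C (UnitO C)) f) = Comp C f (LUnit C A)"
      using \<phi> by (auto intro!: restrict_ext simp: compose_def PiE_iff)
    show "Comp C (RUnit C B) (TensorM C f (Ident C (UnitO C))) = Comp C f (RUnit C A)"
      using \<phi> by (auto intro!: restrict_ext simp: compose_def PiE_iff)
  next
    fix A B D assume "A \<in> Obj C" "B \<in> Obj C" "D \<in> Obj C"
    then show "iso_in C (Assoc C A B D) (TensorO C (TensorO C A B) D) (TensorO C A (TensorO C B D))"
      unfolding C_sel by (intro iso_in_restrict[where g = cart_unassoc]) auto
  next
    fix A assume "A \<in> Obj C"
    then show "iso_in C (LUnit C A) (TensorO C (UnitO C) A) A"
      unfolding C_sel by (intro iso_in_restrict[where g = "Tup Point"]) auto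
  next
    fix A assume "A \<in> Obj C"
    then show "iso_in C (RUnit C A) (TensorO C A (UnitO C)) A"
      unfolding C_sel by (intro iso_in_restrict[where g = "\<lambda>x. Tup x Point"]) auto
  next
    fix A B assume "A \<in> Obj C" "B \<in> Obj C"
    then show "iso_in C (Symm C A B) (TensorO C A B) (TensorO C B A)"
      unfolding C_sel by (intro iso_in_restrict[where g = cart_swap]) auto
  qed (auto intro!: restrict_ext simp: compose_def PiE_iff)
qed

end

text \<open>Such a functor changes neither underlying sets nor functions. Tensors of arrows and
  structural isomorphisms are given by the same formulas on both sides, so they agree as soon as
  their sources and targets do, which is what \<open>F_T\<close> and \<open>F_I\<close>
  provide.\<close>

lemma strict_symmetric_monoidal_functor_concrete:
  assumes "concrete_monoidal_structure Ob U M T I" "concrete_monoidal_structure Ob' U' M' T' I'"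
    and F_Ob: "\<And>A. A \<in> Ob \<Longrightarrow> F A \<in> Ob'"
    and F_U: "\<And>A. U' (F A) = U A"
    and F_M: "\<And>A B f. \<lbrakk>A \<in> Ob; B \<in> Ob; f \<in> U A \<rightarrow> U B; M A B f\<rbrakk> \<Longrightarrow> M' (F A) (F B) f"
    and F_T: "\<And>A B. \<lbrakk>A \<in> Ob; B \<in> Ob\<rbrakk> \<Longrightarrow> F (T A B) = T' (F A) (F B)"
    and F_I: "F I = I'"
  shows "strict_symmetric_monoidal_functor (concrete_monoidal Ob U M T I)
    (concrete_monoidal Ob' U' M' T' I') F (\<lambda>f. Arrow (F (src f)) (fn f) (F (tgt f)))"
proof -
  interpret S: concrete_monoidal_structure Ob U M T I by fact
  interpret S': concrete_monoidal_structure Ob' U' M' T' I' by fact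
  interpret SM: symmetric_monoidal_category S.C by (rule S.symmetric_monoidal_category_C)
  interpret SM': symmetric_monoidal_category S'.C by (rule S'.symmetric_monoidal_category_C)
  note [simp] = F_Ob F_T F_I S.T_Ob S.I_Ob F_U S.U_T S.U_I S'.U_T S'.U_I
  show ?thesis
  proof
    fix f A B assume "f \<in> Hom S.C A B"
    then show "Arrow (F (src f)) (fn f) (F (tgt f)) \<in> Hom S'.C (F A) (F B)"
      by (rule S.HomE) (auto simp: Hom_def S'.Mor_iff intro!: F_M)
  qed (auto simp: Hom_def S.Mor_iff)
qed

section \<open>Finiteness spaces\<close>

abbreviation "cart_fst \<equiv> cart_runit"
abbreviation "cart_snd \<equiv> cart_lunit"

lemma finite_cart: "\<lbrakk>finite X; finite Y\<rbrakk> \<Longrightarrow> finite (cart X Y)"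
  by (rule finite_subset[of _ "(\<lambda>(x, y). Tup x y) ` (X \<times> Y)"]) auto

lemma subset_cartD:
  assumes "w \<subseteq> cart X Y" shows "w \<subseteq> cart (cart_fst ` w) (cart_snd ` w)"
proof
  fix z assume "z \<in> w"
  then obtain x y where "z = Tup x y" using assms by blast
  then show "z \<in> cart (cart_fst ` w) (cart_snd ` w)"
    using \<open>z \<in> w\<close> by (auto simp: rev_image_eqI)
qed

section \<open>Double duals and tests for finitary sets\<close>

lemma subset_perp_perp: "\<U> \<subseteq> Pow X \<Longrightarrow> \<U> \<subseteq> perp X (perp X \<U>)"
  by (auto simp: perp_def Int_commute)

lemma perp_antimono: "\<U> \<subseteq> \<V> \<Longrightarrow> perp X \<V> \<subseteq> perp X \<U>"
  by (auto simp: perp_def)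

text \<open>A triple dual is a single dual, as in every Galois connection: one inclusion is
  \<open>subset_perp_perp\<close> for the dual itself, the other is its instance for the given
  family, reversed by \<open>perp_antimono\<close>.\<close>

lemma finiteness_space_perp:
  assumes "\<U> \<subseteq> Pow X" shows "finiteness_space (FinSpace X (perp X \<U>))"
proof -
  have *: "perp X \<U> \<subseteq> Pow X" for \<U> by (auto simp: perp_def)
  have "perp X (perp X (perp X \<U>)) = perp X \<U>"
    by (intro equalityI perp_antimono subset_perp_perp assms *)
  then show ?thesis
    by (simp add: finiteness_space_def *)
qed

lemma fins_subset_web: "\<lbrakk>finiteness_space A; u \<in> fins A\<rbrakk> \<Longrightarrow> u \<subseteq> web A"
  by (auto simp: finiteness_space_def)

lemma finsI:
  assumes "finiteness_space A" "u \<subseteq> web A" "\<And>u'. u' \<in> cofins A \<Longrightarrow> finite (u \<inter> u')"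
  shows "u \<in> fins A"
proof -
  have "u \<in> perp (web A) (cofins A)"
    using assms unfolding perp_def by blast
  then show ?thesis using assms(1) by (simp add: finiteness_space_def)
qed

lemma cofinsD: "\<lbrakk>u' \<in> cofins A; u \<in> fins A\<rbrakk> \<Longrightarrow> finite (u' \<inter> u)"
  by (simp add: perp_def)

lemma fins_subset:
  assumes "finiteness_space A" "u \<in> fins A" "v \<subseteq> u" shows "v \<in> fins A"
proof (rule finsI[OF assms(1)])
  fix u' assume "u' \<in> cofins A"
  then show "finite (v \<inter> u')"
    using cofinsD[OF _ assms(2)] assms(3) by (metis Int_commute Int_mono finite_subset order_refl)
qed (use fins_subset_web[OF assms(1,2)] assms(3) in auto)

text \<open>Singletons lie in every dual, so the preimage condition contains the finiteness of
  fibres. Conversely, the preimage of \<open>v'\<close> meets \<open>u\<close> in a union of fibres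
  over the intersection of \<open>v'\<close> with the image of \<open>u\<close>, and that
  intersection is finite.\<close>

lemma finf_map_iff:
  assumes "finiteness_space A" "finiteness_space B" "f \<in> web A \<rightarrow> web B"
  shows "finf_map A B f \<longleftrightarrow> (\<forall>u\<in>fins A. f ` u \<in> fins B \<and> (\<forall>y. finite {x\<in>u. f x = y}))"
    (is "_ \<longleftrightarrow> ?R")
proof
  assume f: "finf_map A B f"
  show ?R
  proof (intro ballI conjI allI)
    fix u y assume u: "u \<in> fins A"
    show "finite {x\<in>u. f x = y}"
    proof (cases "y \<in> web B")
      case True
      then have "{y} \<in> cofins B" by (simp add: perp_def)
      then have "finite ((f -` {y} \<inter> web A) \<inter> u)"
        using f u by (intro cofinsD) (auto simp: finf_map_def)
      moreover have "{x\<in>u. f x = y} \<subseteq> (f -` {y} \<inter> web A) \<inter> u"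
        using fins_subset_web[OF assms(1) u] by auto
      ultimately show ?thesis by (rule rev_finite_subset)
    next
      \<comment> \<open>Outside \<open>web B\<close> the singleton is not in the dual, but the fibre
        is empty.\<close>
      case False
      then have "{x\<in>u. f x = y} = {}"
        using fins_subset_web[OF assms(1) u] assms(3) by auto
      then show ?thesis by (metis finite.emptyI)
    qed
  qed (use f in \<open>auto simp: finf_map_def\<close>)
next
  assume R: ?R
  have "f -` v' \<inter> web A \<in> cofins A" if v': "v' \<in> cofins B" for v'
  proof -
    have "finite (f -` v' \<inter> web A \<inter> u)" if u: "u \<in> fins A" for u
    proof (rule finite_subset)
      show "f -` v' \<inter> web A \<inter> u \<subseteq> (\<Union>y\<in>v' \<inter> f ` u. {x\<in>u. f x = y})" by auto
      show "finite (\<Union>y\<in>v' \<inter> f ` u. {x\<in>u. f x = y})"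
        using R u cofinsD[OF v'] by blast
    qed
    then show ?thesis by (auto simp: perp_def)
  qed
  then show "finf_map A B f"
    using R by (auto simp: finf_map_def)
qed

text \<open>Fibres of an injection have at most one point. This settles the dual condition for the
  structural maps and their inverses.\<close>

lemma finf_map_inj:
  assumes "finiteness_space A" "finiteness_space B" "f \<in> web A \<rightarrow> web B" "inj_on f (web A)"
    and "\<And>u. \<lbrakk>u \<in> fins A; u \<subseteq> web A\<rbrakk> \<Longrightarrow> f ` u \<in> fins B"
  shows "finf_map A B f"
  unfolding finf_map_iff[OF assms(1-3)]
proof (intro ballI conjI allI)
  fix u y assume u: "u \<in> fins A"
  have uA: "u \<subseteq> web A" by (rule fins_subset_web[OF assms(1) u])
  show "f ` u \<in> fins B" by (rule assms(5)[OF u uA])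
  have "inj_on f {x\<in>u. f x = y}"
    using assms(4) by (rule inj_on_subset) (use uA in auto)
  moreover have "f ` {x\<in>u. f x = y} \<subseteq> {y}" by auto
  ultimately show "finite {x\<in>u. f x = y}"
    by (meson finite.emptyI finite_insert inj_on_finite)
qed

section \<open>Finitary sets of a tensor product\<close>

lemma web_fin_tensor [simp]: "web (fin_tensor A B) = cart (web A) (web B)"
  by (simp add: fin_tensor_def Let_def)

lemma finiteness_space_fin_tensor: "finiteness_space (fin_tensor A B)"
  unfolding fin_tensor_def Let_def by (rule finiteness_space_perp) (auto simp: perp_def)

text \<open>If the projection \<open>p ` w\<close> meets some \<open>u'\<close> in the dual infinitely often, choosing
  one point of \<open>w\<close> over each point of the intersection gives an infinite subset of \<open>w\<close> that meets
  every set in \<open>\<R>\<close> finitely, so \<open>w\<close> is not in the double dual.\<close>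

lemma image_in_fins_of_perp_perp:
  assumes A: "finiteness_space A" and w: "w \<in> perp Z (perp Z \<R>)" and Z: "p ` Z \<subseteq> web A"
    and R: "\<And>r. r \<in> \<R> \<Longrightarrow> p ` r \<in> fins A"
  shows "p ` w \<in> fins A"
proof (rule finsI[OF A])
  have wZ: "w \<subseteq> Z" using w by (simp add: perp_def)
  then show "p ` w \<subseteq> web A" using Z by auto
  fix u' assume u': "u' \<in> cofins A"
  define z where "z = inv_into w p ` (p ` w \<inter> u')"
  have zw: "z \<subseteq> w" by (auto simp: z_def intro: inv_into_into)
  have inj: "inj_on p z" by (auto simp: z_def inj_on_def f_inv_into_f)
  have pz: "p ` z = p ` w \<inter> u'" by (force simp: z_def image_image f_inv_into_f)
  \<comment> \<open>On \<open>z\<close> the map \<open>p\<close> is injective, so this part of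
    \<open>r\<close> embeds into a set that is finite by duality.\<close>
  have "finite (z \<inter> r)" if "r \<in> \<R>" for r
  proof (rule inj_on_finite)
    show "inj_on p (z \<inter> r)" using inj by (rule inj_on_subset) auto
    show "p ` (z \<inter> r) \<subseteq> u' \<inter> p ` r" using pz by auto
    show "finite (u' \<inter> p ` r)" by (rule cofinsD[OF u' R[OF that]])
  qed
  then have "z \<in> perp Z \<R>" using zw wZ by (auto simp: perp_def)
  then have "finite (w \<inter> z)" using w by (simp add: perp_def)
  then show "finite (p ` w \<inter> u')" using zw pz by (metis finite_imageI inf.absorb2)
qed

text \<open>Rectangles have finitary projections, and this property passes to the double dual.
  Conversely, \<open>w\<close> lies in the rectangle spanned by its two projections, and finitary
  sets are closed under subsets.\<close>

lemma fins_fin_tensor_iff: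
  assumes "finiteness_space A" "finiteness_space B"
  shows "w \<in> fins (fin_tensor A B) \<longleftrightarrow>
    w \<subseteq> cart (web A) (web B) \<and> cart_fst ` w \<in> fins A \<and> cart_snd ` w \<in> fins B"
proof -
  define Z where "Z = cart (web A) (web B)"
  define \<R> where "\<R> = {cart u v | u v. u \<in> fins A \<and> v \<in> fins B}"
  have RZ: "\<R> \<subseteq> Pow Z"
  proof
    fix r assume "r \<in> \<R>"
    then obtain u v where "r = cart u v" "u \<in> fins A" "v \<in> fins B"
      unfolding \<R>_def by blast
    then show "r \<in> Pow Z"
      using fins_subset_web[OF assms(1), of u] fins_subset_web[OF assms(2), of v] by (auto simp: Z_def)
  qed
  have Z: "cart_fst ` Z \<subseteq> web A" "cart_snd ` Z \<subseteq> web B"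
    by (auto simp: Z_def)
  have R: "cart_fst ` r \<in> fins A" "cart_snd ` r \<in> fins B" if rR: "r \<in> \<R>" for r
  proof -
    obtain u v where r: "r = cart u v" "u \<in> fins A" "v \<in> fins B"
      using rR unfolding \<R>_def by blast
    \<comment> \<open>Closure under subsets is used because the projection of
      \<open>cart u v\<close> is empty, rather than \<open>u\<close>, when \<open>v\<close> is
      empty.\<close>
    show "cart_fst ` r \<in> fins A" by (rule fins_subset[OF assms(1) r(2)]) (use r in auto)
    show "cart_snd ` r \<in> fins B" by (rule fins_subset[OF assms(2) r(3)]) (use r in auto)
  qed
  have eq: "fins (fin_tensor A B) = perp Z (perp Z \<R>)"
    by (simp add: fin_tensor_def Let_def Z_def \<R>_def)
  show ?thesis
  proof safe
    assume w: "w \<in> fins (fin_tensor A B)"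
    show "cart_fst ` w \<in> fins A"
      using w unfolding eq by (rule image_in_fins_of_perp_perp[OF assms(1) _ Z(1) R(1)])
    show "cart_snd ` w \<in> fins B"
      using w unfolding eq by (rule image_in_fins_of_perp_perp[OF assms(2) _ Z(2) R(2)])
    show "z \<in> cart (web A) (web B)" if "z \<in> w" for z
      using fins_subset_web[OF finiteness_space_fin_tensor w] that by auto
  next
    assume w: "w \<subseteq> cart (web A) (web B)" "cart_fst ` w \<in> fins A" "cart_snd ` w \<in> fins B"
    then have "cart (cart_fst ` w) (cart_snd ` w) \<in> \<R>"
      unfolding \<R>_def by blast
    then have "cart (cart_fst ` w) (cart_snd ` w) \<in> fins (fin_tensor A B)"
      using subset_perp_perp[OF RZ] unfolding eq by blast
    then show "w \<in> fins (fin_tensor A B)"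
      using fins_subset[OF finiteness_space_fin_tensor] subset_cartD[OF w(1)] by blast
  qed
qed

section \<open>Stability properties of morphisms of finiteness spaces\<close>

lemma finf_map_cong:
  assumes "finiteness_space A" "\<And>x. x \<in> web A \<Longrightarrow> f x = g x" "finf_map A B f"
  shows "finf_map A B g"
proof -
  have "f ` u = g ` u" if "u \<in> fins A" for u
    using fins_subset_web[OF assms(1) that] assms(2) by (auto intro!: image_cong)
  moreover have "f -` v \<inter> web A = g -` v \<inter> web A" for v
    using assms(2) by auto
  ultimately show ?thesis using assms(3) by (simp add: finf_map_def)
qed

lemma finf_map_comp:
  assumes "f \<in> web A \<rightarrow> web B" "finf_map A B f" "finf_map B D g"
  shows "finf_map A D (g \<circ> f)"
proof -
  have pre: "(g \<circ> f) -` v \<inter> web A = f -` (g -` v \<inter> web B) \<inter> web A" for v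
    using assms(1) by auto
  show ?thesis
    using assms(2,3) unfolding finf_map_def pre image_comp[symmetric] by blast
qed

lemma finf_map_cart_map:
  assumes fs: "finiteness_space A" "finiteness_space A'" "finiteness_space B" "finiteness_space B'"
    and f: "f \<in> web A \<rightarrow> web A'" "finf_map A A' f" and g: "g \<in> web B \<rightarrow> web B'" "finf_map B B' g"
  shows "finf_map (fin_tensor A B) (fin_tensor A' B') (cart_map f g)"
proof -
  have fg: "cart_map f g \<in> web (fin_tensor A B) \<rightarrow> web (fin_tensor A' B')"
    using f g by auto
  show ?thesis
    unfolding finf_map_iff[OF finiteness_space_fin_tensor finiteness_space_fin_tensor fg]
  proof (intro ballI conjI allI)
    fix w z assume "w \<in> fins (fin_tensor A B)"
    then have w: "w \<subseteq> cart (web A) (web B)" "cart_fst ` w \<in> fins A" "cart_snd ` w \<in> fins B"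
      using fins_fin_tensor_iff fs by auto
    have "cart_fst ` cart_map f g ` w = f ` cart_fst ` w"
      unfolding image_image by (rule image_cong) (use w in auto)
    moreover have "cart_snd ` cart_map f g ` w = g ` cart_snd ` w"
      unfolding image_image by (rule image_cong) (use w in auto)
    moreover have "cart_map f g ` w \<subseteq> cart (web A') (web B')"
      using w fg by auto
    ultimately show "cart_map f g ` w \<in> fins (fin_tensor A' B')"
      using f g w fs by (simp add: fins_fin_tensor_iff finf_map_def)
    show "finite {x \<in> w. cart_map f g x = z}"
    proof (rule finite_subset)
      \<comment> \<open>A fibre of the product map lies in a product of fibres. If \<open>z\<close>
        is not a pair, the left side is empty, so the values of the projections at \<open>z\<close>
        do not matter.\<close>
      show "{x \<in> w. cart_map f g x = z} \<subseteq>
          cart {x \<in> cart_fst ` w. f x = cart_fst z} {y \<in> cart_snd ` w. g y = cart_snd z}"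
        using subset_cartD[OF w(1)] by fastforce
      show "finite (cart {x \<in> cart_fst ` w. f x = cart_fst z} {y \<in> cart_snd ` w. g y = cart_snd z})"
        using f g w fs by (intro finite_cart) (auto simp: finf_map_iff)
    qed
  qed
qed

lemma fin_unit_sel [simp]: "web fin_unit = {Point}" "fins fin_unit = Pow {Point}"
  by (simp_all add: fin_unit_def)

lemma finiteness_space_fin_unit: "finiteness_space fin_unit"
  by (auto simp: finiteness_space_def fin_unit_def perp_def intro: finite_subset)

lemma concrete_monoidal_structure_FinF:
  "concrete_monoidal_structure {A. finiteness_space A} web finf_map fin_tensor fin_unit"
proof
  note [simp] = finiteness_space_fin_tensor finiteness_space_fin_unit fins_fin_tensor_iff
  fix A B D :: "'a univ finspace"
  assume "A \<in> {A. finiteness_space A}"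
  then have A: "finiteness_space A" by simp
  then show "finf_map A A id" by (auto simp: finf_map_def perp_def Int_assoc Int_absorb1 Int_commute intro: finite_subset)
  show "finf_map (fin_tensor fin_unit A) A cart_lunit"
    by (rule finf_map_inj) (use A in \<open>auto simp: inj_on_def\<close>)
  show "finf_map A (fin_tensor fin_unit A) (Tup Point)"
    by (rule finf_map_inj) (use A in \<open>auto simp: inj_on_def image_image\<close>)
  assume "B \<in> {A. finiteness_space A}"
  then have B: "finiteness_space B" by simp
  show "finf_map (fin_tensor A B) (fin_tensor B A) cart_swap"
  proof (rule finf_map_inj)
    fix w assume w: "w \<in> fins (fin_tensor A B)" "w \<subseteq> web (fin_tensor A B)"
    have "cart_fst ` cart_swap ` w = cart_snd ` w" "cart_snd ` cart_swap ` w = cart_fst ` w"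
      unfolding image_image by (rule image_cong; use w in auto)+
    with A B w show "cart_swap ` w \<in> fins (fin_tensor B A)" by auto
  qed (use A B in \<open>auto simp: inj_on_def\<close>)
  assume "D \<in> {A. finiteness_space A}"
  then have D: "finiteness_space D" by simp
  show "finf_map (fin_tensor (fin_tensor A B) D) (fin_tensor A (fin_tensor B D)) cart_assoc"
  proof (rule finf_map_inj)
    fix w assume w: "w \<in> fins (fin_tensor (fin_tensor A B) D)" "w \<subseteq> web (fin_tensor (fin_tensor A B) D)"
    \<comment> \<open>Rebracketing leaves the three coordinate projections unchanged, and these
      decide membership in both iterated tensor products.\<close>
    have eqs: "cart_fst ` cart_assoc ` w = cart_fst ` cart_fst ` w"
      "cart_fst ` cart_snd ` cart_assoc ` w = cart_snd ` cart_fst ` w"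
      "cart_snd ` cart_snd ` cart_assoc ` w = cart_snd ` w"
      unfolding image_image by (rule image_cong; use w in auto)+
    have "cart_assoc ` w \<subseteq> web (fin_tensor A (fin_tensor B D))"
      "cart_snd ` cart_assoc ` w \<subseteq> web (fin_tensor B D)" using w(2) by auto
    with A B D w(1) show "cart_assoc ` w \<in> fins (fin_tensor A (fin_tensor B D))"
      by (simp only: fins_fin_tensor_iff finiteness_space_fin_tensor web_fin_tensor eqs simp_thms)
  qed (use A B D in \<open>auto simp: inj_on_def\<close>)
  show "finf_map (fin_tensor A (fin_tensor B D)) (fin_tensor (fin_tensor A B) D) cart_unassoc"
  proof (rule finf_map_inj)
    fix w assume w: "w \<in> fins (fin_tensor A (fin_tensor B D))" "w \<subseteq> web (fin_tensor A (fin_tensor B D))"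
    have eqs: "cart_fst ` cart_fst ` cart_unassoc ` w = cart_fst ` w"
      "cart_snd ` cart_fst ` cart_unassoc ` w = cart_fst ` cart_snd ` w"
      "cart_snd ` cart_unassoc ` w = cart_snd ` cart_snd ` w"
      unfolding image_image by (rule image_cong; use w in auto)+
    have "cart_unassoc ` w \<subseteq> web (fin_tensor (fin_tensor A B) D)"
      "cart_fst ` cart_unassoc ` w \<subseteq> web (fin_tensor A B)" using w(2) by auto
    with A B D w(1) show "cart_unassoc ` w \<in> fins (fin_tensor (fin_tensor A B) D)"
      by (simp only: fins_fin_tensor_iff finiteness_space_fin_tensor web_fin_tensor eqs simp_thms)
  qed (use A B D in \<open>auto simp: inj_on_def\<close>)
next
  fix A B :: "'a univ finspace" and f g
  assume "A \<in> {A. finiteness_space A}" "\<And>x. x \<in> web A \<Longrightarrow> f x = g x" "finf_map A B f"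
  then show "finf_map A B g" using finf_map_cong[of A f g B] by simp
next
  fix A B D :: "'a univ finspace" and f g
  assume "f \<in> web A \<rightarrow> web B" "finf_map A B f" "finf_map B D g"
  then show "finf_map A D (g \<circ> f)" by (rule finf_map_comp)
qed (simp_all add: finiteness_space_fin_tensor finiteness_space_fin_unit finf_map_cart_map)

section \<open>Posets and strict maps\<close>

lemma is_posetD:
  assumes "is_poset P"
  shows "x \<in> pts P \<Longrightarrow> (x, x) \<in> leq P" "trans (leq P)" "antisym (leq P)" "leq P \<subseteq> pts P \<times> pts P"
  using assms by (auto simp: is_poset_def partial_order_on_def preorder_on_def refl_on_def)

lemma strict_map_mono:
  assumes "is_poset P" "is_poset Q" "f \<in> pts P \<rightarrow> pts Q" "strict_map P Q f" "(x, y) \<in> leq P"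
  shows "(f x, f y) \<in> leq Q"
proof -
  have xy: "x \<in> pts P" "y \<in> pts P" using is_posetD(4)[OF assms(1)] assms(5) by auto
  show ?thesis
  proof (cases "x = y")
    case True
    then show ?thesis using assms(3) xy is_posetD(1)[OF assms(2)] by auto
  next
    case False
    then show ?thesis using assms(4,5) xy by (simp add: strict_map_def lt_def)
  qed
qed

lemma pts_pos_tensor [simp]: "pts (pos_tensor P Q) = cart (pts P) (pts Q)"
  by (simp add: pos_tensor_def)

lemma leq_pos_tensor_iff [simp]:
  "(Tup x y, Tup x' y') \<in> leq (pos_tensor P Q) \<longleftrightarrow> (x, x') \<in> leq P \<and> (y, y') \<in> leq Q"
  by (simp add: pos_tensor_def)

lemma is_poset_pos_tensor:
  assumes "is_poset P" "is_poset Q"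
  shows "is_poset (pos_tensor P Q)"
  unfolding is_poset_def partial_order_on_def preorder_on_def
proof (intro conjI)
  note P = is_posetD[OF assms(1)] and Q = is_posetD[OF assms(2)]
  show "leq (pos_tensor P Q) \<subseteq> pts (pos_tensor P Q) \<times> pts (pos_tensor P Q)"
    using P(4) Q(4) by (auto simp: pos_tensor_def)
  show "refl_on (pts (pos_tensor P Q)) (leq (pos_tensor P Q))"
    using P(1) Q(1) by (auto simp: refl_on_def)
  show "trans (leq (pos_tensor P Q))"
    using P(2) Q(2) by (auto simp: pos_tensor_def intro!: transI dest: transD)
  show "antisym (leq (pos_tensor P Q))"
    using P(3) Q(3) by (auto simp: pos_tensor_def intro!: antisymI dest: antisymD)
qed

text \<open>A strict inequality of pairs is strict in at least one coordinate, where strictness is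
  preserved. The other coordinate may only be weakly related, hence the appeal to
  \<open>strict_map_mono\<close>.\<close>

lemma strict_map_cart_map:
  assumes "is_poset P" "is_poset P'" "is_poset Q" "is_poset Q'"
    and f: "f \<in> pts P \<rightarrow> pts P'" "strict_map P P' f" and g: "g \<in> pts Q \<rightarrow> pts Q'" "strict_map Q Q' g"
  shows "strict_map (pos_tensor P Q) (pos_tensor P' Q') (cart_map f g)"
  unfolding strict_map_def
proof (intro ballI impI)
  fix z z' assume "z \<in> pts (pos_tensor P Q)" "z' \<in> pts (pos_tensor P Q)"
  then obtain x y x' y' where z: "z = Tup x y" "z' = Tup x' y'"
    "x \<in> pts P" "y \<in> pts Q" "x' \<in> pts P" "y' \<in> pts Q" by auto
  assume "lt (pos_tensor P Q) z z'"
  then have le: "(x, x') \<in> leq P" "(y, y') \<in> leq Q" and ne: "x \<noteq> x' \<or> y \<noteq> y'"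
    by (auto simp: lt_def z)
  have "f x \<noteq> f x' \<or> g y \<noteq> g y'"
    using f(2) g(2) le ne z by (auto simp: strict_map_def lt_def)
  then show "lt (pos_tensor P' Q') (cart_map f g z) (cart_map f g z')"
    using strict_map_mono[OF assms(1,2) f le(1)] strict_map_mono[OF assms(3,4) g le(2)]
    by (simp add: lt_def z)
qed

lemma pos_unit_sel [simp]: "pts pos_unit = {Point}" "leq pos_unit = {(Point, Point)}"
  by (simp_all add: pos_unit_def)

lemma is_poset_pos_unit: "is_poset pos_unit"
  by (simp add: is_poset_def partial_order_on_def preorder_on_def refl_on_def
      trans_def antisym_def)

lemma concrete_monoidal_structure_StrPos:
  "concrete_monoidal_structure {P. is_poset P} pts strict_map pos_tensor pos_unit"
proof
  fix P P' Q Q' :: "'a univ pos" and f g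
  assume "P \<in> {P. is_poset P}" "P' \<in> {P. is_poset P}" "Q \<in> {P. is_poset P}" "Q' \<in> {P. is_poset P}"
    "f \<in> pts P \<rightarrow> pts P'" "g \<in> pts Q \<rightarrow> pts Q'" "strict_map P P' f" "strict_map Q Q' g"
  then show "strict_map (pos_tensor P Q) (pos_tensor P' Q') (cart_map f g)"
    by (simp add: strict_map_cart_map)
qed (auto simp: is_poset_pos_tensor is_poset_pos_unit strict_map_def lt_def Pi_iff)

section \<open>Artinian and narrow subsets\<close>

lemma artinian_narrow_mono_subseq:
  fixes s :: "nat \<Rightarrow> 'u"
  assumes "artinian (induced P u)" "narrow (induced P u)" and s: "\<And>n. s n \<in> u"
    and refl: "\<And>x. x \<in> u \<Longrightarrow> (x, x) \<in> leq P"
  obtains r :: "nat \<Rightarrow> nat" where "strict_mono r" "\<And>i j. i < j \<Longrightarrow> (s (r i), s (r j)) \<in> leq P"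
proof -
  \<comment> \<open>Ramsey's theorem colours unordered pairs of indices; \<open>Min\<close> and
    \<open>Max\<close> recover their order. The colours mean weakly rising, strictly falling and
    incomparable, and narrowness and artinianity exclude the last two on an infinite homogeneous
    set.\<close>
  define c :: "nat set \<Rightarrow> nat" where
    "c X = (if (s (Min X), s (Max X)) \<in> leq P then 0 else if (s (Max X), s (Min X)) \<in> leq P then 1 else 2)" for X
  have c3: "c X < 3" for X by (simp add: c_def)
  have "\<exists>Y t. Y \<subseteq> UNIV \<and> infinite Y \<and> t < 3 \<and> (\<forall>x\<in>Y. \<forall>y\<in>Y. x \<noteq> y \<longrightarrow> c {x, y} = t)"
    by (rule Ramsey2) (simp_all add: c3)
  then obtain Y t where Y: "infinite Y"
    and t: "t < 3" "\<And>x y. \<lbrakk>x \<in> Y; y \<in> Y; x \<noteq> y\<rbrakk> \<Longrightarrow> c {x, y} = t"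
    by blast
  define r where "r = enumerate Y"
  have r: "strict_mono r" using Y by (simp add: r_def strict_mono_enumerate)
  have col: "t = (if (s (r i), s (r j)) \<in> leq P then 0 else if (s (r j), s (r i)) \<in> leq P then 1 else 2)"
    if "i < j" for i j
  proof -
    have "r i < r j" using r that by (simp add: strict_monoD)
    moreover have "c {r i, r j} = t"
      using Y less_imp_neq[OF \<open>r i < r j\<close>] by (intro t(2)) (auto simp: r_def enumerate_in_set)
    moreover have "Min {r i, r j} = r i" "Max {r i, r j} = r j"
      using \<open>r i < r j\<close> by auto
    ultimately show ?thesis by (simp only: c_def)
  qed
  consider "t = 0" | "t = 1" | "t = 2" using t(1) by linarith
  then have "\<forall>i j. i < j \<longrightarrow> (s (r i), s (r j)) \<in> leq P"
  proof cases
    case 1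
    show ?thesis
    proof (intro allI impI)
      fix i j :: nat assume "i < j"
      from col[OF this] 1 show "(s (r i), s (r j)) \<in> leq P" by (simp split: if_splits)
    qed
  next
    case 2
    have "lt (induced P u) (s (r (Suc n))) (s (r n))" for n
    proof -
      have "(s (r n), s (r (Suc n))) \<notin> leq P" "(s (r (Suc n)), s (r n)) \<in> leq P"
        using col[of n "Suc n"] 2 by (simp_all split: if_splits)
      then show ?thesis using s by (auto simp: lt_def induced_def)
    qed
    moreover have "s (r n) \<in> pts (induced P u)" for n
      using s by (simp add: induced_def)
    ultimately have False
      using assms(1) unfolding artinian_def by (elim notE) (intro exI[of _ "\<lambda>n. s (r n)"], simp)
    then show ?thesis ..
  next
    case 3
    have inc: "(s (r i), s (r j)) \<notin> leq P \<and> (s (r j), s (r i)) \<notin> leq P" if "i \<noteq> j" for i j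
    proof (cases "i < j")
      case True
      from col[OF this] 3 show ?thesis by (simp split: if_splits)
    next
      case False
      with that have "j < i" by simp
      from col[OF this] 3 show ?thesis by (simp split: if_splits)
    qed
    \<comment> \<open>Equal values would be comparable by reflexivity, so the antichain is really
      infinite.\<close>
    have "inj (\<lambda>n. s (r n))"
    proof (rule injI)
      fix i j assume eq: "s (r i) = s (r j)"
      show "i = j" using inc[of i j] eq refl[OF s, of "r j"] by fastforce
    qed
    then have "infinite (range (\<lambda>n. s (r n)))" by (rule range_inj_infinite)
    moreover have "range (\<lambda>n. s (r n)) \<subseteq> pts (induced P u)"
      using s by (auto simp: induced_def)
    moreover have "(s (r i), s (r j)) \<notin> leq (induced P u) \<and> (s (r j), s (r i)) \<notin> leq (induced P u)"
      if "s (r i) \<noteq> s (r j)" for i j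
      using inc[of i j] that by (auto simp: induced_def)
    then have "\<forall>x\<in>range (\<lambda>n. s (r n)). \<forall>y\<in>range (\<lambda>n. s (r n)). x \<noteq> y \<longrightarrow>
        (x, y) \<notin> leq (induced P u) \<and> (y, x) \<notin> leq (induced P u)" by blast
    ultimately have False using assms(2) unfolding narrow_def by blast
    then show ?thesis ..
  qed
  with r show ?thesis by (intro that[of r]) simp_all
qed

text \<open>Antisymmetry keeps the composite of two strict steps strict. The consequence for
  arbitrary \<open>i < j\<close> is what contradicts a good pair in a descending sequence.\<close>

lemma lt_decseq:
  assumes "trans (leq P)" "antisym (leq P)" "\<And>n. lt P (s (Suc n)) (s n)" "i < j"
  shows "lt P (s j) (s i)"
  using assms(4)
proof (induction rule: less_Suc_induct)
  case (1 i)
  show ?case by (rule assms(3))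
next
  case (2 i j k)
  then show ?case
    using transD[OF assms(1)] antisymD[OF assms(2)] unfolding lt_def by metis
qed

lemma fins_E_obj_subset: "u \<in> fins (E_obj P) \<Longrightarrow> u \<subseteq> pts P"
  by (simp add: E_obj_def)

lemma fins_E_obj_mono_subseq:
  fixes s :: "nat \<Rightarrow> 'u"
  assumes "is_poset P" "u \<in> fins (E_obj P)" "\<And>n. s n \<in> u"
  obtains r :: "nat \<Rightarrow> nat" where "strict_mono r" "\<And>i j. i < j \<Longrightarrow> (s (r i), s (r j)) \<in> leq P"
proof (rule artinian_narrow_mono_subseq[of P u s])
  show "(x, x) \<in> leq P" if "x \<in> u" for x
    using is_posetD(1)[OF assms(1)] fins_E_obj_subset[OF assms(2)] that by blast
qed (use assms that in \<open>simp_all add: E_obj_def\<close>)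

lemma fins_E_objE:
  fixes s :: "nat \<Rightarrow> 'u"
  assumes "is_poset P" "u \<in> fins (E_obj P)" "\<And>n. s n \<in> u"
  obtains i j where "i < j" "(s i, s j) \<in> leq P"
proof (rule fins_E_obj_mono_subseq[OF assms])
  fix r :: "nat \<Rightarrow> nat" assume "strict_mono r" "\<And>i j. i < j \<Longrightarrow> (s (r i), s (r j)) \<in> leq P"
  then show thesis using that[of "r 0" "r 1"] by (simp add: strict_monoD)
qed

text \<open>An infinite strictly descending sequence, and likewise an injective enumeration inside
  an infinite antichain, has no \<open>i < j\<close> with \<open>s i\<close> below
  \<open>s j\<close>.\<close>

lemma fins_E_objI:
  assumes P: "is_poset P" and sub: "u \<subseteq> pts P"
    and good: "\<And>s :: nat \<Rightarrow> _. (\<And>n. s n \<in> u) \<Longrightarrow> \<exists>i j. i < j \<and> (s i, s j) \<in> leq P"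
  shows "u \<in> fins (E_obj P)"
proof -
  have "artinian (induced P u)"
    unfolding artinian_def
  proof (intro notI, elim exE conjE)
    fix s :: "nat \<Rightarrow> _"
    assume s: "\<forall>n. s n \<in> pts (induced P u)" "\<forall>n. lt (induced P u) (s (Suc n)) (s n)"
    have "lt P (s (Suc n)) (s n)" for n
      using s(2) by (auto simp: lt_def induced_def)
    note dec = lt_decseq[of P s, OF is_posetD(2,3)[OF P] this]
    have "s n \<in> u" for n using s(1) by (simp add: induced_def)
    then obtain i j where "i < j" "(s i, s j) \<in> leq P"
      using good[of s] by auto
    with dec[of i j] is_posetD(3)[OF P] show False by (auto simp: lt_def dest: antisymD)
  qed
  moreover have "narrow (induced P u)"
    unfolding narrow_def
  proof (intro allI impI, rule ccontr)
    fix S assume S: "S \<subseteq> pts (induced P u)"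
      and inc: "\<forall>x\<in>S. \<forall>y\<in>S. x \<noteq> y \<longrightarrow> (x, y) \<notin> leq (induced P u) \<and> (y, x) \<notin> leq (induced P u)"
      and "infinite S"
    then obtain s :: "nat \<Rightarrow> _" where s: "inj s" "range s \<subseteq> S"
      using infinite_countable_subset by blast
    have su: "s n \<in> S" "s n \<in> u" for n using s(2) S by (auto simp: induced_def)
    obtain i j where ij: "i < j" "(s i, s j) \<in> leq P"
      using good[of s] su by auto
    have "s i \<noteq> s j" using s(1) ij(1) by (simp add: inj_eq)
    then have "(s i, s j) \<notin> leq (induced P u)" using inc su by blast
    with ij su show False by (simp add: induced_def)
  qed
  ultimately show ?thesis using sub by (simp add: E_obj_def)
qed

section \<open>The functor on objects, morphisms and tensor products\<close>

lemma web_E_obj [simp]: "web (E_obj P) = pts P"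
  by (simp add: E_obj_def)

text \<open>The range of a sequence \<open>s\<close> without \<open>i < j\<close> and \<open>s i \<le> s j\<close> meets every artinian and
  narrow set finitely, so no set in the double dual contains such a sequence.\<close>

lemma finiteness_space_E_obj:
  assumes P: "is_poset P" shows "finiteness_space (E_obj P)"
proof -
  let ?U = "fins (E_obj P)"
  have UX: "?U \<subseteq> Pow (pts P)" by (auto simp: E_obj_def)
  have "u \<in> ?U" if u: "u \<in> perp (pts P) (perp (pts P) ?U)" for u
  proof (rule fins_E_objI[OF P])
    show sub: "u \<subseteq> pts P" using u by (simp add: perp_def)
    fix s :: "nat \<Rightarrow> _" assume s: "\<And>n. s n \<in> u"
    show "\<exists>i j. i < j \<and> (s i, s j) \<in> leq P"
    proof (rule ccontr)
      assume "\<not> ?thesis"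
      then have bad: "(s i, s j) \<notin> leq P" if "i < j" for i j using that by blast
      \<comment> \<open>A repeated value would be a good pair by reflexivity. Injectivity makes the
        range of \<open>s\<close> infinite, which the final contradiction needs.\<close>
      have inj: "inj s"
      proof (rule linorder_injI)
        fix i j :: nat assume "i < j"
        moreover have "(s i, s i) \<in> leq P" using is_posetD(1)[OF P] s[of i] sub by blast
        ultimately show "s i \<noteq> s j" using bad[of i j] by auto
      qed
      have "finite (range s \<inter> v)" if v: "v \<in> ?U" for v
      proof -
        \<comment> \<open>Infinitely many such indices, listed in increasing order, would give a
          subsequence inside \<open>v\<close>, and a good pair in it is a good pair of
          \<open>s\<close>.\<close>
        have "finite {n. s n \<in> v}"
        proof (rule ccontr)
          assume inf: "infinite {n. s n \<in> v}"
          let ?r = "enumerate {n. s n \<in> v}"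
          have "s (?r n) \<in> v" for n using enumerate_in_set[OF inf] by simp
          then obtain i j where "i < j" "(s (?r i), s (?r j)) \<in> leq P"
            by (rule fins_E_objE[OF P v])
          with bad enumerate_mono[OF _ inf] show False by blast
        qed
        moreover have "range s \<inter> v = s ` {n. s n \<in> v}" by auto
        ultimately show ?thesis by simp
      qed
      then have "range s \<in> perp (pts P) ?U" using s sub by (auto simp: perp_def)
      then have "finite (u \<inter> range s)" using u by (simp add: perp_def)
      moreover have "u \<inter> range s = range s" using s by auto
      ultimately show False using range_inj_infinite[OF inj] by simp
    qed
  qed
  with subset_perp_perp[OF UX] UX show ?thesis
    unfolding finiteness_space_def web_E_obj by blast
qed

text \<open>For images, monotonicity suffices: lift the sequence, find a good pair, and map it back.
  Strictness is what makes fibres finite: a good pair of an injective sequence is strictly related,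
  so its images cannot coincide.\<close>

lemma strict_map_imp_finf_map:
  assumes P: "is_poset P" and Q: "is_poset Q" and f: "f \<in> pts P \<rightarrow> pts Q" "strict_map P Q f"
  shows "finf_map (E_obj P) (E_obj Q) f"
proof -
  have f': "f \<in> web (E_obj P) \<rightarrow> web (E_obj Q)" using f by simp
  show ?thesis
    unfolding finf_map_iff[OF finiteness_space_E_obj[OF P] finiteness_space_E_obj[OF Q] f']
  proof (intro ballI conjI allI)
    fix u y assume u: "u \<in> fins (E_obj P)"
    note sub = fins_E_obj_subset[OF u]
    show "f ` u \<in> fins (E_obj Q)"
    proof (rule fins_E_objI[OF Q])
      show "f ` u \<subseteq> pts Q" using f sub by auto
      fix s :: "nat \<Rightarrow> _" assume s: "\<And>n. s n \<in> f ` u"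
      define t where "t n = inv_into u f (s n)" for n
      have t: "t n \<in> u" "s n = f (t n)" for n
        using s[of n] by (simp_all add: t_def inv_into_into f_inv_into_f)
      obtain i j where "i < j" "(t i, t j) \<in> leq P"
        using t(1) by (rule fins_E_objE[OF P u])
      then have "i < j \<and> (s i, s j) \<in> leq Q" using strict_map_mono[OF P Q f] t(2) by simp
      then show "\<exists>i j. i < j \<and> (s i, s j) \<in> leq Q" by blast
    qed
    show "finite {x\<in>u. f x = y}"
    proof (rule ccontr)
      assume "infinite {x\<in>u. f x = y}"
      then obtain s :: "nat \<Rightarrow> _" where s: "inj s" "range s \<subseteq> {x\<in>u. f x = y}"
        using infinite_countable_subset by blast
      then have su: "s n \<in> u" "f (s n) = y" for n by auto
      obtain i j where ij: "i < j" "(s i, s j) \<in> leq P"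
        using su(1) by (rule fins_E_objE[OF P u])
      then have "lt P (s i) (s j)" using s(1) by (simp add: lt_def inj_eq)
      then have "lt Q (f (s i)) (f (s j))"
        using f(2) su(1) sub unfolding strict_map_def by blast
      then show False using su by (simp add: lt_def)
    qed
  qed
qed

text \<open>Projections of a product of posets preserve the order but need not be strict, so they
  are not covered by the result on strict maps. The lifting argument for images still
  applies.\<close>

lemma fins_E_obj_image:
  assumes P: "is_poset P" and R: "is_poset R" and w: "w \<in> fins (E_obj R)"
    and p: "p ` pts R \<subseteq> pts P" "\<And>z z'. (z, z') \<in> leq R \<Longrightarrow> (p z, p z') \<in> leq P"
  shows "p ` w \<in> fins (E_obj P)"
proof (rule fins_E_objI[OF P])
  show "p ` w \<subseteq> pts P" using fins_E_obj_subset[OF w] p(1) by auto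
  fix s :: "nat \<Rightarrow> _" assume s: "\<And>n. s n \<in> p ` w"
  define t where "t n = inv_into w p (s n)" for n
  have t: "t n \<in> w" "s n = p (t n)" for n
    using s[of n] by (simp_all add: t_def inv_into_into f_inv_into_f)
  obtain i j where "i < j" "(t i, t j) \<in> leq R"
    using t(1) by (rule fins_E_objE[OF R w])
  then have "i < j \<and> (s i, s j) \<in> leq P" using p(2) t(2) by simp
  then show "\<exists>i j. i < j \<and> (s i, s j) \<in> leq P" by blast
qed

lemma E_obj_pos_tensor:
  assumes P: "is_poset P" and Q: "is_poset Q"
  shows "E_obj (pos_tensor P Q) = fin_tensor (E_obj P) (E_obj Q)"
proof -
  note PQ = is_poset_pos_tensor[OF P Q]
  have "w \<in> fins (E_obj (pos_tensor P Q)) \<longleftrightarrow> w \<in> fins (fin_tensor (E_obj P) (E_obj Q))" for w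
    unfolding fins_fin_tensor_iff[OF finiteness_space_E_obj[OF P] finiteness_space_E_obj[OF Q]] web_E_obj
  proof (intro iffI conjI)
    assume w: "w \<in> fins (E_obj (pos_tensor P Q))"
    show "w \<subseteq> cart (pts P) (pts Q)"
      using fins_E_obj_subset[OF w] by simp
    show "cart_fst ` w \<in> fins (E_obj P)"
      by (rule fins_E_obj_image[OF P PQ w]) (auto simp: pos_tensor_def)
    show "cart_snd ` w \<in> fins (E_obj Q)"
      by (rule fins_E_obj_image[OF Q PQ w]) (auto simp: pos_tensor_def)
  next
    assume "w \<subseteq> cart (pts P) (pts Q) \<and> cart_fst ` w \<in> fins (E_obj P) \<and> cart_snd ` w \<in> fins (E_obj Q)"
    then have w: "w \<subseteq> cart (pts P) (pts Q)" "cart_fst ` w \<in> fins (E_obj P)"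
      "cart_snd ` w \<in> fins (E_obj Q)" by auto
    show "w \<in> fins (E_obj (pos_tensor P Q))"
    proof (rule fins_E_objI[OF PQ])
      show "w \<subseteq> pts (pos_tensor P Q)" using w by simp
      fix s :: "nat \<Rightarrow> _" assume s: "\<And>n. s n \<in> w"
      have "cart_fst (s n) \<in> cart_fst ` w" for n using s by simp
      then obtain r :: "nat \<Rightarrow> nat" where r: "strict_mono r"
        "\<And>i j. i < j \<Longrightarrow> (cart_fst (s (r i)), cart_fst (s (r j))) \<in> leq P"
        by (rule fins_E_obj_mono_subseq[OF P w(2), of "\<lambda>n. cart_fst (s n)"]) (rule that, simp_all)
      have "cart_snd (s (r n)) \<in> cart_snd ` w" for n using s by simp
      then obtain i j where ij: "i < j" "(cart_snd (s (r i)), cart_snd (s (r j))) \<in> leq Q"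
        by (rule fins_E_objE[OF Q w(3)])
      \<comment> \<open>All elements of \<open>w\<close> are pairs, so the projections determine
        them and the order can be compared coordinatewise.\<close>
      have "s n = Tup (cart_fst (s n)) (cart_snd (s n))" for n
        using subsetD[OF w(1), of "s n"] s by auto
      then have "(s (r i), s (r j)) \<in> leq (pos_tensor P Q)"
        using leq_pos_tensor_iff r(2)[OF ij(1)] ij(2) by metis
      with strict_monoD[OF r(1) ij(1)] show "\<exists>i j. i < j \<and> (s i, s j) \<in> leq (pos_tensor P Q)"
        by blast
    qed
  qed
  then have "fins (E_obj (pos_tensor P Q)) = fins (fin_tensor (E_obj P) (E_obj Q))" by blast
  then show ?thesis by (intro finspace.expand) simp
qed

lemma E_obj_pos_unit: "E_obj pos_unit = fin_unit"
proof -
  have "u \<in> fins (E_obj pos_unit)" if u: "u \<subseteq> {Point}" for u :: "'a univ set"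
  proof (rule fins_E_objI[OF is_poset_pos_unit])
    fix s :: "nat \<Rightarrow> 'a univ" assume s: "\<And>n. s n \<in> u"
    have "s 0 = Point" "s 1 = Point" using s[of 0] s[of 1] u by auto
    then have "0 < (1::nat) \<and> (s 0, s 1) \<in> leq pos_unit" by simp
    then show "\<exists>i j. i < j \<and> (s i, s j) \<in> leq pos_unit" by blast
  qed (use u in simp)
  moreover have "u \<subseteq> {Point}" if "u \<in> fins (E_obj pos_unit)" for u :: "'a univ set"
    using fins_E_obj_subset[OF that] by simp
  ultimately have "fins (E_obj (pos_unit :: 'a univ pos)) = Pow {Point}" by blast
  then show ?thesis by (intro finspace.expand) simp
qed

theorem lemma4p6:
  shows "strict_symmetric_monoidal_functor
    (StrPos :: ('a univ pos, ('a univ pos, 'a univ) arrow) monoidal_data) FinF E_obj E_mor"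
proof -
  have E: "E_mor = (\<lambda>f. Arrow (E_obj (src f)) (fn f) (E_obj (tgt f)))"
    by (simp add: E_mor_def fun_eq_iff)
  show ?thesis
    unfolding StrPos_def FinF_def E
    by (rule strict_symmetric_monoidal_functor_concrete[OF concrete_monoidal_structure_StrPos
          concrete_monoidal_structure_FinF])
      (auto simp: finiteness_space_E_obj strict_map_imp_finf_map E_obj_pos_tensor E_obj_pos_unit)
qed

end
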